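(* Let $0<p\le 1/2$, $1/2\le s\le 1$ and $\epsilon>0$, and for each $m$ let $n=n(m)$ satisfy $n\ge(1+\epsilon)\,m\log(1/p)$. Let the hash functions have the type-class statistical profile $P_H(b)=2^{-m(H(q(b))+D(q(b)\|p))}$ for all $b\in\{1,\dots,2^m\}$. Assume that users' passwords are drawn i.i.d. Bernoulli$(1/2)$ bitwise, and that they are mapped to a set $B=B_m$ of $|B|=2^{H(s)m-1}$ distinct bins (the size read as $\max\{1,\lfloor 2^{H(s)m-1}\rfloor\}$). Then, for any such sets of occupied bins, the conditional average guesswork under an insider attack satisfies $$ L(s,p)\;\le\;\lim_{m\to\infty}\frac1m\log E\big(G_{insider}(B)\big)\;\le\; D(s\|p), \qquad L(s,p)=\begin{cases}D(1-s\|p), & 0\le 1-s\le p,\\ 0,& p\le 1-s\le 1/2,\end{cases} $$ whenever the limit exists.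
   Context: Logarithms are base 2. $H(q)=-q\log q-(1-q)\log(1-q)$ is the binary entropy and $D(q\|p)=q\log\frac qp+(1-q)\log\frac{1-q}{1-p}$ (with $0\log 0=0$). A hash function is a map $H_F:\{1,\dots,2^n\}\to\{1,\dots,2^m\}$, $n>m$; outputs are called bins and are identified with binary strings of length $m$. The type of a bin $b$ is $q(b)=N(1|b)/m$, with $N(1|b)$ the number of ones in $b$. The statistical profile of $H_F$ is $P_H(b)=2^{-n}|\{i:H_F(i)=b\}|$. For a given profile $P_H$ (so each $2^nP_H(b)$ is an integer), the $P_H$-set of hash functions is the set of all hash functions with profile $P_H$. Note that $2^{-m(H(q(b))+D(q(b)\|p))}=p^{N(1|b)}(1-p)^{m-N(1|b)}$. A guessing strategy is an ordering of the $2^n$ inputs; inputs are guessed one by one in this order without repetition. For a set $B$ of bins (the set of occupied bins, i.e. the hash values of users' passwords), $G_{insider}(B)$ is the number of guesses up to and including the first guessed input that is mapped to any element of $B$. $E(G_{insider}(B))$, for fixed $B$, is the average taken in either of two ways (the result is asserted for both): (i) for an arbitrary fixed strategy, over a hash function drawn uniformly from the $P_H$-set; or (ii) for an arbitrary fixed hash function in the $P_H$-set, over a uniformly random strategy. *)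

theory Defs
  imports "HOL-Probability.Probability"
begin

text \<open>As \<^const>\<open>log\<close> is total, the convention \<open>0 log 0 = 0\<close> holds in the next two definitions.\<close>

definition bin_entropy :: "real \<Rightarrow> real" where
  "bin_entropy q = - q * log 2 q - (1 - q) * log 2 (1 - q)"

definition bin_div :: "real \<Rightarrow> real \<Rightarrow> real" where
  "bin_div q p = q * log 2 (q / p) + (1 - q) * log 2 ((1 - q) / (1 - p))"

definition inputs :: "nat \<Rightarrow> nat set" where
  "inputs n = {1..2 ^ n}"

text \<open>The \<open>2 ^ m\<close> bins are represented by the binary strings of length \<open>m\<close> they are identified
  with.\<close>

definition bins :: "nat \<Rightarrow> bool list set" where
  "bins m = {b. length b = m}"

definition bin_type :: "bool list \<Rightarrow> real" where
  "bin_type b = real (count_list b True) / real (length b)"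

text \<open>Hash functions are \<^const>\<open>undefined\<close> outside \<open>inputs n\<close>, so that there are finitely many
  of them and each counts once in an average.\<close>

definition hash_functions :: "nat \<Rightarrow> nat \<Rightarrow> (nat \<Rightarrow> bool list) set" where
  "hash_functions n m = inputs n \<rightarrow>\<^sub>E bins m"

definition profile :: "nat \<Rightarrow> (nat \<Rightarrow> bool list) \<Rightarrow> bool list \<Rightarrow> real" where
  "profile n h b = real (card {i \<in> inputs n. h i = b}) / 2 ^ n"

definition profile_set :: "nat \<Rightarrow> nat \<Rightarrow> (bool list \<Rightarrow> real) \<Rightarrow> (nat \<Rightarrow> bool list) set" where
  "profile_set n m P = {h \<in> hash_functions n m. \<forall>b\<in>bins m. profile n h b = P b}"

definition type_profile :: "real \<Rightarrow> nat \<Rightarrow> bool list \<Rightarrow> real" where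
  "type_profile p m b =
     2 powr (- (real m * (bin_entropy (bin_type b) + bin_div (bin_type b) p)))"

text \<open>A strategy is the list of all inputs, each occurring once, in the order of guessing.\<close>

definition strategies :: "nat \<Rightarrow> nat list set" where
  "strategies n = permutations_of_set (inputs n)"

definition G_insider :: "(nat \<Rightarrow> bool list) \<Rightarrow> nat list \<Rightarrow> bool list set \<Rightarrow> nat" where
  "G_insider h \<sigma> B = Suc (length (takeWhile (\<lambda>i. h i \<notin> B) \<sigma>))"

text \<open>The two readings of the average guesswork conditional on the set \<open>B\<close> of occupied bins: over
  the hash functions with profile \<open>P\<close> for a fixed strategy, and over the strategies for a fixed hash
  function. As \<open>B\<close> is fixed, the law of the passwords that occupy it does not enter.\<close>

definition E_hash :: "nat \<Rightarrow> nat \<Rightarrow> (bool list \<Rightarrow> real) \<Rightarrow> nat list \<Rightarrow> bool list set \<Rightarrow> real" where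
  "E_hash n m P \<sigma> B =
     measure_pmf.expectation (pmf_of_set (profile_set n m P)) (\<lambda>h. real (G_insider h \<sigma> B))"

definition E_strategy :: "nat \<Rightarrow> (nat \<Rightarrow> bool list) \<Rightarrow> bool list set \<Rightarrow> real" where
  "E_strategy n h B =
     measure_pmf.expectation (pmf_of_set (strategies n)) (\<lambda>\<sigma>. real (G_insider h \<sigma> B))"

definition L_bound :: "real \<Rightarrow> real \<Rightarrow> real" where
  "L_bound s p = (if 1 - s \<le> p then bin_div (1 - s) p else 0)"

end

theory Submission imports Defs begin

text \<open>Let \<open>P(B)\<close> be the total profile of the occupied bins. In both readings the \<open>2^n P(B)\<close> inputs
  that hit \<open>B\<close> are in uniformly random position among the \<open>2^n\<close> inputs, so that
  \<open>E = (2^n + 1) / (2^n P(B) + 1)\<close>, which lies between \<open>1 / (2 P(B))\<close> and \<open>1 / P(B)\<close>. It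
  remains to estimate the exponent of \<open>P(B)\<close>. For \<open>t > s\<close> there are at most \<open>2^(m H(t))\<close> bins of type
  above \<open>t\<close>, which is negligible against \<open>|B|\<close>; all other bins of \<open>B\<close> have profile at least
  \<open>2^(- m (H(t) + D(t|p)))\<close>, and \<open>t\<close> tends to \<open>s\<close>. In the other direction, for \<open>t = 1 - s \<le> p\<close> all
  bins of type below \<open>t\<close> together have profile at most \<open>2^(- m D(t|p))\<close>, and so do the bins of \<open>B\<close> of
  type at least \<open>t\<close>, since there are at most \<open>2^(m H(t))\<close> of them.\<close>

section \<open>Entropy, divergence and cross entropy\<close>

text \<open>The exponent of the type-class profile, in a form that is affine in \<open>q\<close>:
  comparing profiles of two types then needs only the sign of a slope.\<close>

definition cross_entropy :: "real \<Rightarrow> real \<Rightarrow> real" where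
  "cross_entropy q p = - q * log 2 p - (1 - q) * log 2 (1 - p)"

lemma cross_entropy_self: "cross_entropy q q = bin_entropy q"
  by (simp add: cross_entropy_def bin_entropy_def)

text \<open>The slope \<open>log 2 (1 - p) - log 2 p\<close> is nonnegative for
  \<open>p \<le> 1/2\<close> and nonpositive for \<open>p \<ge> 1/2\<close>. The estimates below use
  the first sign for the parameter \<open>p\<close>, the second for an auxiliary parameter
  \<open>t \<ge> 1/2\<close>.\<close>

lemma cross_entropy_diff:
  "cross_entropy q p - cross_entropy t p = (q - t) * (log 2 (1 - p) - log 2 p)"
  by (simp add: cross_entropy_def algebra_simps)

lemma bin_entropy_plus_bin_div:
  assumes "0 < p" "p < 1" "0 \<le> q" "q \<le> 1"
  shows "bin_entropy q + bin_div q p = cross_entropy q p"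
proof -
  have "q * log 2 (q / p) = q * log 2 q - q * log 2 p"
    using assms by (cases "q = 0") (auto simp: log_divide algebra_simps)
  moreover have "(1 - q) * log 2 ((1 - q) / (1 - p)) = (1 - q) * log 2 (1 - q) - (1 - q) * log 2 (1 - p)"
    using assms by (cases "q = 1") (auto simp: log_divide algebra_simps)
  ultimately show ?thesis
    by (simp add: bin_entropy_def bin_div_def cross_entropy_def)
qed

lemma bin_entropy_complement: "bin_entropy (1 - q) = bin_entropy q"
  by (simp add: bin_entropy_def algebra_simps)

lemma bin_entropy_nonneg:
  assumes "0 \<le> q" "q \<le> 1"
  shows "0 \<le> bin_entropy q"
proof -
  have "q * log 2 q \<le> 0"
    using assms by (cases "q = 0") (auto intro!: mult_nonneg_nonpos)
  moreover have "(1 - q) * log 2 (1 - q) \<le> 0"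
    using assms by (cases "q = 1") (auto intro!: mult_nonneg_nonpos)
  ultimately show ?thesis by (simp add: bin_entropy_def)
qed

text \<open>The derivative \<open>log 2 (1 - x) - log 2 x\<close> is negative beyond 1/2. The strict
  gap is what makes the bins of type above \<open>t\<close> negligible against a set of size about
  \<open>2^(m H(s))\<close>.\<close>

lemma bin_entropy_strict_decreasing:
  assumes "1/2 \<le> s" "s < t" "t < 1"
  shows "bin_entropy t < bin_entropy s"
proof -
  have deriv: "(bin_entropy has_real_derivative (log 2 (1 - x) - log 2 x)) (at x)"
    if "0 < x" "x < 1" for x
  proof -
    have "((\<lambda>q. - q * (ln q / ln 2) - (1 - q) * (ln (1 - q) / ln 2)) has_real_derivative
        - ((ln x + 1) / ln 2) - (- ln (1 - x) - 1) / ln 2) (at x)"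
      using that by (auto intro!: derivative_eq_intros)
    moreover have "log 2 (1 - x) - log 2 x = - ((ln x + 1) / ln 2) - (- ln (1 - x) - 1) / ln 2"
      by (simp add: log_def field_simps)
    ultimately show ?thesis
      by (simp only: bin_entropy_def [abs_def] log_def)
  qed
  show ?thesis
  proof (rule DERIV_neg_imp_decreasing_open[OF assms(2)])
    fix x assume x: "s < x" "x < t"
    show "\<exists>y. (bin_entropy has_real_derivative y) (at x) \<and> y < 0"
      using x assms by (intro exI[of _ "log 2 (1 - x) - log 2 x"] conjI deriv) auto
  next
    show "continuous_on {s..t} bin_entropy"
      using assms by (intro continuous_at_imp_continuous_on ballI DERIV_isCont[OF deriv]) auto
  qed
qed

section \<open>The type-class profile as a product measure, and its mass on a set of bins\<close>

lemma finite_bins: "finite (bins m)"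
  using finite_lists_length_eq[of "UNIV :: bool set" m] by (simp add: bins_def)

lemma bin_type_bounds: "0 \<le> bin_type b" "bin_type b \<le> 1"
  by (auto simp: bin_type_def count_le_length divide_le_eq_1)

lemma count_list_True_False: "count_list b True + count_list b False = length b"
  by (induction b) auto

lemma type_profile_eq_powr:
  assumes "0 < p" "p < 1"
  shows "type_profile p m b = 2 powr (- (real m * cross_entropy (bin_type b) p))"
  using bin_entropy_plus_bin_div[OF assms bin_type_bounds] by (simp add: type_profile_def)

lemma type_profile_eq_power:
  assumes p: "0 < p" "p < 1" and "m \<ge> 1" "b \<in> bins m"
  shows "type_profile p m b = p ^ count_list b True * (1 - p) ^ count_list b False"
proof -
  have b: "real (length b) = real m" "real m > 0" using assms by (auto simp: bins_def)
  have "real m * bin_type b = real (count_list b True)"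
    using b by (simp add: bin_type_def)
  moreover have "real m - real (count_list b True) = real (count_list b False)"
    using count_list_True_False[of b] b by linarith
  moreover have "- (real m * cross_entropy (bin_type b) p)
      = real m * bin_type b * log 2 p + (real m - real m * bin_type b) * log 2 (1 - p)"
    by (simp add: cross_entropy_def algebra_simps)
  ultimately have "- (real m * cross_entropy (bin_type b) p)
      = real (count_list b True) * log 2 p + real (count_list b False) * log 2 (1 - p)"
    by simp
  moreover have "2 powr (real k * log 2 x) = x ^ k" if "0 < x" for k x
    using that by (simp add: log_nat_power[symmetric])
  ultimately show ?thesis
    using p by (simp add: type_profile_eq_powr powr_add)
qed

text \<open>These are the weights of \<open>m\<close> independent Bernoulli bits; conditioning on
  the first bit gives the induction.\<close>

lemma sum_bins_power:
  "(\<Sum>b\<in>bins m. p ^ count_list b True * (1 - p) ^ count_list b False) = (1 :: real)"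
proof (induction m)
  case 0
  have "bins 0 = {[]}" by (auto simp: bins_def)
  then show ?case by simp
next
  case (Suc m)
  let ?w = "\<lambda>b. p ^ count_list b True * (1 - p) ^ count_list b False"
  have "bins (Suc m) = (#) True ` bins m \<union> (#) False ` bins m"
    by (auto simp: bins_def length_Suc_conv image_iff)
  then have "sum ?w (bins (Suc m)) = sum ?w ((#) True ` bins m) + sum ?w ((#) False ` bins m)"
    by (simp only:) (rule sum.union_disjoint; auto simp: finite_bins)
  also have "\<dots> = p * sum ?w (bins m) + (1 - p) * sum ?w (bins m)"
    by (simp add: sum.reindex inj_on_def sum_distrib_left mult.assoc mult.left_commute)
  finally show ?case using Suc.IH by simp
qed

lemma sum_type_profile:
  assumes "0 < p" "p < 1" "m \<ge> 1"
  shows "(\<Sum>b\<in>bins m. type_profile p m b) = 1"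
  using sum_bins_power[of p m] assms by (simp add: type_profile_eq_power cong: sum.cong)

lemma type_profile_pos: "0 < type_profile p m b"
  by (simp add: type_profile_def)

text \<open>Used for the given parameter and also, as a change of measure, for the parameter
  \<open>t\<close> of a threshold type.\<close>

lemma sum_type_profile_subset_le_1:
  assumes "0 < p" "p < 1" "m \<ge> 1" "C \<subseteq> bins m"
  shows "(\<Sum>b\<in>C. type_profile p m b) \<le> 1"
  using sum_mono2[OF finite_bins assms(4), of "type_profile p m"] assms
  by (simp add: sum_type_profile less_imp_le type_profile_pos)

text \<open>Below type \<open>t\<close> the profile is large; above type \<open>t\<close> the product measure with parameter \<open>t\<close> is
  large, so there are few such bins.\<close>

lemma sum_type_profile_ge:
  assumes p: "0 < p" "p \<le> 1/2" and t: "1/2 \<le> t" "t < 1" and m: "m \<ge> 1" and C: "C \<subseteq> bins m"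
  shows "2 powr (- (real m * cross_entropy t p)) * (real (card C) - 2 powr (real m * bin_entropy t))
         \<le> (\<Sum>b\<in>C. type_profile p m b)"
proof -
  define c d where "c = 2 powr (- (real m * cross_entropy t p))"
    and "d = 2 powr (- (real m * bin_entropy t))"
  have cd: "c > 0" "d > 0" by (auto simp: c_def d_def)
  \<comment> \<open>At every bin one of the two terms alone is at least 1: the first if its type is
    at most \<open>t\<close>, otherwise the second. Summing over \<open>C\<close> then needs no
    split.\<close>
  have "1 \<le> type_profile p m b / c + type_profile t m b / d" for b
  proof (cases "bin_type b \<le> t")
    case True
    have "cross_entropy (bin_type b) p - cross_entropy t p \<le> 0"
      unfolding cross_entropy_diff using True p by (intro mult_nonpos_nonneg) auto
    then have "c \<le> type_profile p m b"
      using p m by (simp add: c_def type_profile_eq_powr)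
    then have "1 \<le> type_profile p m b / c" using cd by simp
    then show ?thesis using cd type_profile_pos[of t m b] by (smt (verit) divide_pos_pos)
  next
    case False
    have "cross_entropy (bin_type b) t - cross_entropy t t \<le> 0"
      unfolding cross_entropy_diff using False t by (intro mult_nonneg_nonpos) auto
    then have "d \<le> type_profile t m b"
      using t m by (simp add: d_def type_profile_eq_powr cross_entropy_self)
    then have "1 \<le> type_profile t m b / d" using cd by simp
    then show ?thesis using cd type_profile_pos[of p m b] by (smt (verit) divide_pos_pos)
  qed
  then have "(\<Sum>b\<in>C. 1) \<le> (\<Sum>b\<in>C. type_profile p m b / c + type_profile t m b / d)"
    by (rule sum_mono)
  then have "real (card C) \<le> (\<Sum>b\<in>C. type_profile p m b) / c + (\<Sum>b\<in>C. type_profile t m b) / d"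
    by (simp add: sum.distrib sum_divide_distrib)
  also have "(\<Sum>b\<in>C. type_profile t m b) / d \<le> 1 / d"
    using sum_type_profile_subset_le_1[of t m C] t m C cd by (simp add: divide_right_mono)
  also have "1 / d = 2 powr (real m * bin_entropy t)"
    by (simp add: d_def powr_minus field_simps)
  finally show ?thesis using cd by (simp add: c_def[symmetric] field_simps)
qed

text \<open>Split \<open>C\<close> at type \<open>t\<close>. The low part is a Chernoff bound by
  change of measure from \<open>p\<close> to \<open>t\<close> and needs no bound on the size; the
  high part is the number of bins times the largest profile available there. Each part costs
  \<open>2^(-m D(t|p))\<close>.\<close>

lemma sum_type_profile_le:
  assumes p: "0 < p" "p \<le> 1/2" and t: "0 \<le> t" "t \<le> p" and m: "m \<ge> 1" and C: "C \<subseteq> bins m"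
    and card: "real (card C) \<le> 2 powr (real m * bin_entropy t)"
  shows "(\<Sum>b\<in>C. type_profile p m b) \<le> 2 * 2 powr (- (real m * bin_div t p))"
proof -
  define c e where "c = 2 powr (- (real m * cross_entropy t p))"
    and "e = 2 powr (- (real m * bin_div t p))"
  have fin: "finite C" using C finite_bins finite_subset by blast
  have div: "bin_div t p = cross_entropy t p - bin_entropy t"
    using bin_entropy_plus_bin_div[of p t] p t by simp
  have c: "type_profile p m b \<le> c" if "t \<le> bin_type b" for b
  proof -
    have "cross_entropy (bin_type b) p - cross_entropy t p \<ge> 0"
      unfolding cross_entropy_diff using that p by (intro mult_nonneg_nonneg) auto
    then show ?thesis using p m by (simp add: c_def type_profile_eq_powr)
  qed
  have low: "(\<Sum>b\<in>C \<inter> {b. bin_type b < t}. type_profile p m b) \<le> e"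
  \<comment> \<open>For \<open>t = 0\<close> there is no Bernoulli measure with parameter in (0, 1)
    to change to, but no type lies below 0 either.\<close>
  proof (cases "t = 0")
    case True
    have "C \<inter> {b. bin_type b < t} = {}"
      by (auto simp: True leD[OF bin_type_bounds(1)])
    then show ?thesis by (simp add: e_def)
  next
    case False
    with t have t0: "0 < t" "t < 1" using p by auto
    have "type_profile p m b \<le> e * type_profile t m b" if "bin_type b < t" for b
    proof -
      \<comment> \<open>As functions of the type, the exponents for \<open>p\<close> and for
        \<open>t\<close> differ by exactly \<open>bin_div t p\<close> at type \<open>t\<close>.
        Since \<open>t \<le> p\<close>, the exponent for \<open>p\<close> has the smaller slope, so
        to the left of \<open>t\<close> the difference can only grow.\<close>
      have "log 2 (1 - p) \<le> log 2 (1 - t)" "log 2 t \<le> log 2 p"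
        using p t t0 by auto
      then have "(bin_type b - t) * ((log 2 (1 - p) - log 2 p) - (log 2 (1 - t) - log 2 t)) \<ge> 0"
        using that by (intro mult_nonpos_nonpos) auto
      then have "cross_entropy (bin_type b) t + bin_div t p \<le> cross_entropy (bin_type b) p"
        using cross_entropy_diff[of "bin_type b" p t] cross_entropy_diff[of "bin_type b" t t]
        by (simp add: div cross_entropy_self right_diff_distrib)
      then have "real m * (cross_entropy (bin_type b) t + bin_div t p)
          \<le> real m * cross_entropy (bin_type b) p"
        by (intro mult_left_mono) auto
      then show ?thesis using p t0
        by (simp add: e_def type_profile_eq_powr powr_add[symmetric] distrib_left)
    qed
    then have "(\<Sum>b\<in>C \<inter> {b. bin_type b < t}. type_profile p m b)
        \<le> e * (\<Sum>b\<in>C \<inter> {b. bin_type b < t}. type_profile t m b)"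
      unfolding sum_distrib_left by (intro sum_mono) auto
    also have "\<dots> \<le> e * 1"
      using C t0 m by (intro mult_left_mono sum_type_profile_subset_le_1) (auto simp: e_def)
    finally show ?thesis by simp
  qed
  have "(\<Sum>b\<in>C \<inter> - {b. bin_type b < t}. type_profile p m b) \<le> real (card (C \<inter> - {b. bin_type b < t})) * c"
    using c by (intro sum_bounded_above) auto
  also have "\<dots> \<le> 2 powr (real m * bin_entropy t) * c"
    using card card_mono[OF fin, of "C \<inter> - {b. bin_type b < t}"]
    by (intro mult_right_mono) (auto simp: c_def)
  also have "\<dots> = e"
    by (simp add: c_def e_def div powr_add[symmetric] algebra_simps)
  finally have high: "(\<Sum>b\<in>C \<inter> - {b. bin_type b < t}. type_profile p m b) \<le> e" .
  have "(\<Sum>b\<in>C. type_profile p m b) = (\<Sum>b\<in>C \<inter> {b. bin_type b < t}. type_profile p m b)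
      + (\<Sum>b\<in>C \<inter> - {b. bin_type b < t}. type_profile p m b)"
    using sum.Int_Diff[OF fin, of "type_profile p m" "{b. bin_type b < t}"] by (simp add: Diff_eq)
  with low high show ?thesis by (simp add: e_def)
qed

section \<open>Average guesswork over random strategies\<close>

text \<open>Recursion on the first guess \<open>x\<close>: a hit ends the search, and a miss leaves
  the same problem on \<open>A - {x}\<close> with the same number of hits. With no hits at all the
  guesswork is \<open>card A + 1\<close>, in agreement with the formula.\<close>

lemma sum_length_takeWhile_permutations:
  assumes "finite A"
  shows "(\<Sum>\<sigma>\<in>permutations_of_set A. real (Suc (length (takeWhile (\<lambda>i. \<not> Q i) \<sigma>))))
           * (real (card {i\<in>A. Q i}) + 1) = (real (card A) + 1) * fact (card A)"
  using assms
proof (induction "card A" arbitrary: A)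
  case 0
  then show ?case by simp
next
  case (Suc N A)
  let ?f = "\<lambda>\<sigma>. real (Suc (length (takeWhile (\<lambda>i. \<not> Q i) \<sigma>)))"
  let ?K = "real (card {i\<in>A. Q i})"
  have A: "finite A" "A \<noteq> {}" "card A = Suc N" using Suc.hyps Suc.prems by auto
  have card': "card (permutations_of_set (A - {x})) = fact N" if "x \<in> A" for x
    using A that by (simp add: card_permutations_of_set)
  have "sum ?f (permutations_of_set A)
      = (\<Sum>x\<in>A. sum ?f ((#) x ` permutations_of_set (A - {x})))"
    using A by (subst permutations_of_set_nonempty) (auto intro!: sum.UNION_disjoint)
  \<comment> \<open>The 1 is the first guess itself; only after a miss does the rest of the strategy
    count.\<close>
  also have "\<dots> = (\<Sum>x\<in>A. \<Sum>\<sigma>\<in>permutations_of_set (A - {x}). 1 + (if Q x then 0 else ?f \<sigma>))"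
    by (rule sum.cong[OF refl], subst sum.reindex) (auto intro!: sum.cong)
  also have "\<dots> = (\<Sum>x\<in>A. fact N + (if Q x then 0 else sum ?f (permutations_of_set (A - {x}))))"
    by (intro sum.cong refl) (simp add: sum.distrib card')
  also have "\<dots> = fact (Suc N) + (\<Sum>x\<in>{x\<in>A. \<not> Q x}. sum ?f (permutations_of_set (A - {x})))"
    using A by (simp add: sum.distrib sum.If_cases Int_def algebra_simps)
  finally have rec: "sum ?f (permutations_of_set A)
      = fact (Suc N) + (\<Sum>x\<in>{x\<in>A. \<not> Q x}. sum ?f (permutations_of_set (A - {x})))" .
  have "sum ?f (permutations_of_set (A - {x})) * (?K + 1) = (real N + 1) * fact N"
    if "x \<in> A" "\<not> Q x" for x
  proof -
    have "{i \<in> A - {x}. Q i} = {i\<in>A. Q i}" using that by auto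
    then show ?thesis using Suc.hyps(1)[of "A - {x}"] A that by simp
  qed
  then have "(\<Sum>x\<in>{x\<in>A. \<not> Q x}. sum ?f (permutations_of_set (A - {x}))) * (?K + 1)
      = (\<Sum>x\<in>{x\<in>A. \<not> Q x}. (real N + 1) * fact N)"
    unfolding sum_distrib_right by (intro sum.cong refl) blast
  then have "(\<Sum>x\<in>{x\<in>A. \<not> Q x}. sum ?f (permutations_of_set (A - {x}))) * (?K + 1)
      = real (card {x\<in>A. \<not> Q x}) * fact (Suc N)"
    by (simp add: algebra_simps)
  moreover have "real (card {x\<in>A. \<not> Q x}) = real (Suc N) - ?K"
  proof -
    have "{x\<in>A. Q x} \<union> {x\<in>A. \<not> Q x} = A" "{x\<in>A. Q x} \<inter> {x\<in>A. \<not> Q x} = {}" by blast+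
    then show ?thesis
      using A card_Un_disjoint[of "{x\<in>A. Q x}" "{x\<in>A. \<not> Q x}"] by simp
  qed
  \<comment> \<open>Each of the \<open>Suc N - ?K\<close> misses contributes
    \<open>fact (Suc N)\<close>, so \<open>?K\<close> cancels and the factor
    \<open>Suc N + 1\<close> remains.\<close>
  ultimately have "sum ?f (permutations_of_set A) * (?K + 1)
      = fact (Suc N) * (?K + 1) + (real (Suc N) - ?K) * fact (Suc N)"
    unfolding rec by (simp only: distrib_right)
  also have "\<dots> = (real (card A) + 1) * fact (card A)"
    unfolding A(3) by (simp only: algebra_simps)
  finally show ?case .
qed

lemma finite_inputs: "finite (inputs n)" and card_inputs: "card (inputs n) = 2 ^ n"
  by (auto simp: inputs_def)

lemma finite_strategies: "finite (strategies n)"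
  and card_strategies: "card (strategies n) = fact (2 ^ n)"
  and strategies_nonempty: "strategies n \<noteq> {}"
  by (auto simp: strategies_def finite_inputs card_inputs card_permutations_of_set
      permutations_of_set_empty_iff)

lemma finite_profile_set: "finite (profile_set n m P)"
  unfolding profile_set_def hash_functions_def
  by (intro finite_subset[OF Collect_restrict] finite_PiE finite_inputs finite_bins)

lemma E_strategy_eq:
  "E_strategy n h B = (2 ^ n + 1) / (real (card {i\<in>inputs n. h i \<in> B}) + 1)"
proof -
  have "(\<Sum>\<sigma>\<in>strategies n. real (G_insider h \<sigma> B)) * (real (card {i\<in>inputs n. h i \<in> B}) + 1)
      = (2 ^ n + 1) * fact (2 ^ n)"
    using sum_length_takeWhile_permutations[OF finite_inputs, where Q = "\<lambda>i. h i \<in> B"]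
    by (simp add: strategies_def G_insider_def card_inputs)
  moreover have "real (card {i\<in>inputs n. h i \<in> B}) + 1 > 0" by linarith
  moreover have "E_strategy n h B = (\<Sum>\<sigma>\<in>strategies n. real (G_insider h \<sigma> B)) / fact (2 ^ n)"
    unfolding E_strategy_def
    by (simp add: integral_pmf_of_set strategies_nonempty finite_strategies card_strategies)
  ultimately have "fact (2 ^ n) * (E_strategy n h B * (real (card {i\<in>inputs n. h i \<in> B}) + 1))
      = fact (2 ^ n) * (2 ^ n + 1)" and pos: "real (card {i\<in>inputs n. h i \<in> B}) + 1 > 0"
    by (simp_all add: mult.commute)
  then have "E_strategy n h B * (real (card {i\<in>inputs n. h i \<in> B}) + 1) = 2 ^ n + 1"
    by (simp only: mult_left_cancel[OF fact_nonzero])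
  then show ?thesis using pos by (simp add: nonzero_eq_divide_eq)
qed

lemma card_preimage_profile_set:
  assumes h: "h \<in> profile_set n m P" and B: "B \<subseteq> bins m"
  shows "real (card {i\<in>inputs n. h i \<in> B}) = 2 ^ n * (\<Sum>b\<in>B. P b)"
proof -
  have fin: "finite B" using B finite_bins finite_subset by blast
  have "{i\<in>inputs n. h i \<in> B} = (\<Union>b\<in>B. {i\<in>inputs n. h i = b})" by auto
  then have "card {i\<in>inputs n. h i \<in> B} = (\<Sum>b\<in>B. card {i\<in>inputs n. h i = b})"
    using fin by (simp only:) (rule card_UN_disjoint; auto simp: finite_inputs)
  moreover have "real (card {i\<in>inputs n. h i = b}) = 2 ^ n * P b" if "b \<in> B" for b
    using h B that by (auto simp: profile_set_def profile_def field_simps)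
  ultimately show ?thesis by (simp add: sum_distrib_left)
qed

section \<open>Average guesswork over random hash functions\<close>

lemma strategies_relabel:
  assumes "\<sigma> \<in> strategies n" "\<tau> \<in> strategies n"
  obtains \<pi> where "bij_betw \<pi> (inputs n) (inputs n)" "map \<pi> \<sigma> = \<tau>"
proof -
  let ?N = "length \<sigma>"
  have \<sigma>: "distinct \<sigma>" "set \<sigma> = inputs n" and \<tau>: "distinct \<tau>" "set \<tau> = inputs n"
    using assms by (auto simp: strategies_def permutations_of_set_def)
  have len: "length \<tau> = ?N"
    using \<sigma> \<tau> distinct_card by metis
  \<comment> \<open>\<open>\<pi>\<close> sends the input at each position of \<open>\<sigma>\<close>
    to the input at the same position of \<open>\<tau>\<close>.\<close>
  define \<pi> where "\<pi> = (!) \<tau> \<circ> the_inv_into {..<?N} ((!) \<sigma>)"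
  have bs: "bij_betw ((!) \<sigma>) {..<?N} (inputs n)" and bt: "bij_betw ((!) \<tau>) {..<?N} (inputs n)"
    using \<sigma> \<tau> len by (auto intro: bij_betw_nth)
  have "bij_betw \<pi> (inputs n) (inputs n)"
    unfolding \<pi>_def using bij_betw_the_inv_into[OF bs] bt by (rule bij_betw_trans)
  moreover have "map \<pi> \<sigma> = \<tau>"
    using bs by (intro nth_equalityI) (auto simp: len \<pi>_def the_inv_into_f_f bij_betw_def)
  ultimately show thesis by (rule that)
qed

lemma profile_set_relabel:
  assumes \<pi>: "bij_betw \<pi> (inputs n) (inputs n)" and h: "h \<in> profile_set n m P"
  shows "restrict (h \<circ> \<pi>) (inputs n) \<in> profile_set n m P"
proof -
  have "card {i\<in>inputs n. h (\<pi> i) = b} = card {i\<in>inputs n. h i = b}" for b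
  proof (rule bij_betw_same_card[of \<pi>])
    show "bij_betw \<pi> {i\<in>inputs n. h (\<pi> i) = b} {i\<in>inputs n. h i = b}"
      using \<pi> unfolding bij_betw_def inj_on_def by (auto simp: image_iff)
  qed
  then have "profile n (restrict (h \<circ> \<pi>) (inputs n)) b = profile n h b" for b
    by (simp add: profile_def cong: conj_cong)
  moreover have "restrict (h \<circ> \<pi>) (inputs n) \<in> hash_functions n m"
    using h bij_betwE[OF \<pi>] by (auto simp: profile_set_def hash_functions_def)
  ultimately show ?thesis using h by (simp add: profile_set_def)
qed

text \<open>Guessing along \<open>\<tau>\<close> against \<open>h\<close> is guessing along
  \<open>\<sigma>\<close> against \<open>h \<circ> \<pi>\<close>, and composition with
  \<open>\<pi>\<close> permutes the hash functions of a given profile. So the average over hash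
  functions does not depend on the strategy.\<close>

lemma sum_G_insider_relabel:
  assumes \<sigma>: "\<sigma> \<in> strategies n" and \<tau>: "\<tau> \<in> strategies n"
  shows "(\<Sum>h\<in>profile_set n m P. real (G_insider h \<sigma> B))
       = (\<Sum>h\<in>profile_set n m P. real (G_insider h \<tau> B))"
proof -
  obtain \<pi> where \<pi>: "bij_betw \<pi> (inputs n) (inputs n)" and map: "map \<pi> \<sigma> = \<tau>"
    using strategies_relabel[OF assms] by metis
  let ?r = "\<lambda>\<pi> h. restrict (h \<circ> \<pi>) (inputs n) :: nat \<Rightarrow> bool list"
  let ?\<rho> = "the_inv_into (inputs n) \<pi>"
  have \<rho>: "bij_betw ?\<rho> (inputs n) (inputs n)" by (rule bij_betw_the_inv_into[OF \<pi>])
  have inv: "?r \<pi> (?r ?\<rho> h) = h" "?r ?\<rho> (?r \<pi> h) = h" if "h \<in> profile_set n m P" for h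
  proof -
    \<comment> \<open>Extensionality makes the two restricted compositions mutually inverse as total
      functions.\<close>
    have "h \<in> extensional (inputs n)"
      using that by (auto simp: profile_set_def hash_functions_def PiE_def)
    then show "?r \<pi> (?r ?\<rho> h) = h" "?r ?\<rho> (?r \<pi> h) = h"
      using \<pi> \<rho> bij_betwE[OF \<pi>] bij_betwE[OF \<rho>]
      by (auto intro!: extensionalityI[of _ "inputs n"]
          simp: the_inv_into_f_f f_the_inv_into_f_bij_betw bij_betw_def)
  qed
  have "G_insider h \<tau> B = G_insider (?r \<pi> h) \<sigma> B" for h
  proof -
    have "set \<sigma> = inputs n" using \<sigma> by (simp add: strategies_def permutations_of_set_def)
    then have "takeWhile (\<lambda>i. h (\<pi> i) \<notin> B) \<sigma> = takeWhile (\<lambda>i. ?r \<pi> h i \<notin> B) \<sigma>"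
      by (intro takeWhile_cong) auto
    then show ?thesis by (simp add: G_insider_def map[symmetric] takeWhile_map o_def)
  qed
  then show ?thesis
    by (intro sum.reindex_bij_witness[of _ "?r \<pi>" "?r ?\<rho>"])
      (auto simp: inv intro!: profile_set_relabel \<pi> \<rho> simp del: o_apply)
qed

text \<open>Double counting: averaging additionally over all strategies changes nothing, and after
  swapping the sums the inner average is \<open>E_strategy\<close>, which has the same value for
  every hash function of the profile.\<close>

lemma E_hash_eq:
  assumes \<sigma>: "\<sigma> \<in> strategies n" and ne: "profile_set n m P \<noteq> {}" and B: "B \<subseteq> bins m"
  shows "E_hash n m P \<sigma> B = (2 ^ n + 1) / (2 ^ n * (\<Sum>b\<in>B. P b) + 1)"
proof -
  let ?H = "profile_set n m P" and ?S = "strategies n"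
  let ?E = "(2 ^ n + 1) / (2 ^ n * (\<Sum>b\<in>B. P b) + 1)"
  have "real (card ?S) * (\<Sum>h\<in>?H. real (G_insider h \<sigma> B))
      = (\<Sum>\<tau>\<in>?S. \<Sum>h\<in>?H. real (G_insider h \<tau> B))"
    by (subst sum.cong[OF refl sum_G_insider_relabel[OF _ \<sigma>]]) simp_all
  also have "\<dots> = (\<Sum>h\<in>?H. \<Sum>\<tau>\<in>?S. real (G_insider h \<tau> B))"
    by (rule sum.swap)
  also have "\<dots> = (\<Sum>h\<in>?H. real (card ?S) * E_strategy n h B)"
    by (simp add: E_strategy_def integral_pmf_of_set strategies_nonempty finite_strategies
        card_strategies)
  also have "\<dots> = (\<Sum>h\<in>?H. real (card ?S) * ?E)"
    by (intro sum.cong refl) (simp add: E_strategy_eq card_preimage_profile_set[OF _ B])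
  also have "\<dots> = real (card ?S) * (real (card ?H) * ?E)"
    by (simp only: sum_constant mult.left_commute)
  finally have "(\<Sum>h\<in>?H. real (G_insider h \<sigma> B)) = real (card ?H) * ?E"
    by (simp only: mult_left_cancel card_strategies of_nat_fact fact_nonzero not_False_eq_True)
  then show ?thesis
    unfolding E_hash_def using ne by (simp add: integral_pmf_of_set finite_profile_set)
qed

text \<open>Lets \<open>pmf_of_set\<close> be the uniform distribution on the profile set. The
  witness lists each bin \<open>b\<close> exactly \<open>2 ^ n * P b\<close> times and reads the
  hash values off that list.\<close>

lemma profile_set_nonempty:
  assumes int: "\<And>b. b \<in> bins m \<Longrightarrow> 2 ^ n * P b \<in> \<int>"
    and nonneg: "\<And>b. b \<in> bins m \<Longrightarrow> 0 \<le> P b" and sum: "(\<Sum>b\<in>bins m. P b) = 1"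
  shows "profile_set n m P \<noteq> {}"
proof -
  define c where "c b = nat \<lfloor>2 ^ n * P b\<rfloor>" for b
  have c: "real (c b) = 2 ^ n * P b" if "b \<in> bins m" for b
    using int[OF that] nonneg[OF that] by (auto simp: c_def elim!: Ints_cases)
  define M where "M = (\<Sum>b\<in>bins m. replicate_mset (c b) b)"
  obtain xs where xs: "mset xs = M" using ex_mset by blast
  have "real (size M) = (\<Sum>b\<in>bins m. real (c b))"
    by (simp add: M_def size_multiset_sum)
  also have "\<dots> = 2 ^ n" using sum by (simp add: c sum_distrib_left[symmetric])
  finally have "length xs = 2 ^ n"
    using xs by (metis of_nat_eq_iff of_nat_numeral of_nat_power size_mset)
  have cnt: "count M b = c b" if "b \<in> bins m" for b
    using that finite_bins by (simp add: M_def count_sum)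
  have set: "set xs \<subseteq> bins m"
    using arg_cong[OF xs, of set_mset] finite_bins by (auto simp: M_def set_mset_sum split: if_splits)
  \<comment> \<open>Inputs start at 1 and list positions at 0.\<close>
  define h where "h = restrict (\<lambda>i. xs ! (i - 1)) (inputs n)"
  have "card {i\<in>inputs n. h i = b} = count M b" for b
  proof -
    have "card {i\<in>inputs n. h i = b} = card {j. j < length xs \<and> xs ! j = b}"
      by (rule bij_betw_same_card[of "\<lambda>i. i - 1"],
          rule bij_betw_byWitness[of _ Suc])
        (auto simp: h_def inputs_def \<open>length xs = 2 ^ n\<close>)
    also have "\<dots> = count (mset xs) b"
      by (simp add: count_mset count_list_eq_length_filter length_filter_conv_card eq_commute)
    finally show ?thesis by (simp add: xs)
  qed
  then have "profile n h b = P b" if "b \<in> bins m" for b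
    using that by (simp add: profile_def cnt c)
  moreover have "h \<in> hash_functions n m"
    using set \<open>length xs = 2 ^ n\<close>
    by (auto simp: h_def hash_functions_def inputs_def subset_iff)
  ultimately show ?thesis by (auto simp: profile_set_def)
qed

section \<open>Exponential rate of the average guesswork\<close>

text \<open>Both readings of the average have the closed form assumed for \<open>E\<close>, so the
  asymptotics are carried out once for that form.\<close>

lemma insider_rate_bounds:
  fixes B :: "nat \<Rightarrow> bool list set" and n :: "nat \<Rightarrow> nat"
  assumes p: "0 < p" "p \<le> 1/2" and s: "1/2 \<le> s" "s \<le> 1"
    and B: "\<And>m. m \<ge> 1 \<Longrightarrow> B m \<subseteq> bins m"
    and card: "\<And>m. m \<ge> 1 \<Longrightarrow>
      card (B m) = max 1 (nat \<lfloor>2 powr (bin_entropy s * real m - 1)\<rfloor>)"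
    and K: "\<And>m. m \<ge> 1 \<Longrightarrow> 2 ^ n m * (\<Sum>b\<in>B m. type_profile p m b) \<in> \<int>"
    and E: "\<And>m. m \<ge> 1 \<Longrightarrow>
      E m = (2 ^ n m + 1) / (2 ^ n m * (\<Sum>b\<in>B m. type_profile p m b) + 1)"
    and lim: "(\<lambda>m. 1 / real m * log 2 (E m)) \<longlonglongrightarrow> l"
  shows "L_bound s p \<le> l \<and> l \<le> bin_div s p"
proof -
  define P where "P m = (\<Sum>b\<in>B m. type_profile p m b)" for m
  have p1: "p < 1" using p by simp
  have cardB: "2 powr (bin_entropy s * real m) / 4 \<le> real (card (B m))"
      "real (card (B m)) \<le> 2 powr (real m * bin_entropy s)" "1 \<le> real (card (B m))"
    if "m \<ge> 1" for m
  proof -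
    define x where "x = 2 powr (bin_entropy s * real m - 1)"
    have x: "2 powr (bin_entropy s * real m) = 2 * x" "x > 0"
      by (simp_all add: x_def powr_diff)
    \<comment> \<open>Nonnegative entropy gives \<open>x \<ge> 1/2\<close>, so the floor and the
      maximum with 1 change \<open>x\<close> by at most a factor 2 either way.\<close>
    have "bin_entropy s * real m \<ge> 0" using bin_entropy_nonneg[of s] s by simp
    then have "2 * x \<ge> 1" unfolding x(1)[symmetric] by (rule ge_one_powr_ge_zero[rotated]) simp
    moreover have c: "real (card (B m)) = max 1 (real_of_int \<lfloor>x\<rfloor>)"
      using x(2) by (simp add: card[OF that] x_def[symmetric] of_nat_max)
    moreover have "real_of_int \<lfloor>x\<rfloor> \<le> x" "x < real_of_int \<lfloor>x\<rfloor> + 1" by linarith+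
    ultimately have "x \<le> 2 * real (card (B m))" "real (card (B m)) \<le> 2 * x" "1 \<le> real (card (B m))"
      using x(2) by linarith+
    then show "2 powr (bin_entropy s * real m) / 4 \<le> real (card (B m))"
      "real (card (B m)) \<le> 2 powr (real m * bin_entropy s)" "1 \<le> real (card (B m))"
      unfolding mult.commute[of "real m"] x(1) by simp_all
  qed
  have P: "0 < P m" "P m \<le> 1" if "m \<ge> 1" for m
  proof -
    have "B m \<noteq> {}" using cardB(3)[OF that] by auto
    moreover have "finite (B m)" using B[OF that] finite_bins finite_subset by blast
    ultimately show "0 < P m" unfolding P_def by (intro sum_pos type_profile_pos)
    show "P m \<le> 1"
      unfolding P_def using p p1 that B[OF that] by (intro sum_type_profile_subset_le_1)
  qed
  have E_bounds: "1 / (2 * P m) \<le> E m" "E m \<le> 1 / P m" if m: "m \<ge> 1" for m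
  proof -
    have pos: "0 < 2 ^ n m * P m" using P[OF m] by simp
    obtain k where k: "2 ^ n m * P m = real_of_int k"
      using K[OF m] by (auto simp: P_def elim: Ints_cases)
    \<comment> \<open>The number of inputs hitting \<open>B m\<close> is a positive integer, so the
      \<open>+ 1\<close> in the denominator of \<open>E m\<close> at most doubles it; this frees the
      bounds from \<open>n\<close>.\<close>
    have "1 \<le> 2 ^ n m * P m" using pos unfolding k by simp
    then have "2 ^ n m * P m + 1 \<le> (2 ^ n m + 1) * (2 * P m)"
      using P[OF m] by (simp add: algebra_simps)
    then show "1 / (2 * P m) \<le> E m"
      using P[OF m] pos unfolding E[OF m] P_def[symmetric]
      by (simp add: pos_divide_le_eq pos_le_divide_eq add_pos_pos)
    have "(2 ^ n m + 1) * P m \<le> 2 ^ n m * P m + 1"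
      using P[OF m] by (simp add: algebra_simps)
    then show "E m \<le> 1 / P m"
      using P[OF m] pos unfolding E[OF m] P_def[symmetric]
      by (simp add: pos_divide_le_eq pos_le_divide_eq add_pos_pos)
  qed
  have E_pos: "0 < E m" if "m \<ge> 1" for m
    using E_bounds(1)[OF that] P[OF that] by (smt (verit) divide_pos_pos)
  \<comment> \<open>Constant factors in the bounds on \<open>P m\<close> shift the rate only by a
    constant over \<open>m\<close>: here 2 bits, in \<open>upper\<close> 3 bits.\<close>
  have lower: "a \<le> l" if le: "\<And>m. m \<ge> 1 \<Longrightarrow> P m \<le> 2 * 2 powr (- (real m * a))" for a
  proof (rule LIMSEQ_le[OF _ lim])
    show "(\<lambda>m. a - 2 * (1 / real m)) \<longlonglongrightarrow> a"
      using tendsto_diff[OF tendsto_const[of a] tendsto_mult[OF tendsto_const[of 2] lim_1_over_n]]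
      by simp
    have "a - 2 * (1 / real m) \<le> 1 / real m * log 2 (E m)" if m: "m \<ge> 1" for m
    proof -
      have "2 powr (real m * a - 2) = 1 / (2 * (2 * 2 powr (- (real m * a))))"
        by (simp add: powr_diff powr_minus field_simps)
      also have "\<dots> \<le> 1 / (2 * P m)"
        using le[OF m] P[OF m] by (intro divide_left_mono) auto
      also have "\<dots> \<le> E m" by (rule E_bounds[OF m])
      finally have "real m * a - 2 \<le> log 2 (E m)"
        using E_pos[OF m] by (simp add: le_log_iff)
      then have "(real m * a - 2) / real m \<le> log 2 (E m) / real m"
        by (rule divide_right_mono) simp
      then show ?thesis using m by (simp add: diff_divide_distrib)
    qed
    then show "\<exists>N. \<forall>m\<ge>N. a - 2 * (1 / real m) \<le> 1 / real m * log 2 (E m)" by blast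
  qed
  have upper: "l \<le> a" if "\<forall>\<^sub>F m in sequentially. 2 powr (- (real m * a)) / 8 \<le> P m" for a
  proof (rule tendsto_le[OF _ _ lim])
    show "(\<lambda>m. a + 3 * (1 / real m)) \<longlonglongrightarrow> a"
      using tendsto_add[OF tendsto_const[of a] tendsto_mult[OF tendsto_const[of 3] lim_1_over_n]]
      by simp
    show "\<forall>\<^sub>F m in sequentially. 1 / real m * log 2 (E m) \<le> a + 3 * (1 / real m)"
      using that eventually_ge_at_top[of 1]
    proof eventually_elim
      case (elim m)
      have "E m \<le> 1 / P m" by (rule E_bounds[OF elim(2)])
      also have "\<dots> \<le> 1 / (2 powr (- (real m * a)) / 8)"
        using elim(1) P[OF elim(2)] by (intro divide_left_mono) auto
      also have "\<dots> = 2 powr (real m * a + 3)"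
        by (simp add: powr_add powr_minus field_simps)
      finally have "log 2 (E m) \<le> real m * a + 3"
        using E_pos[OF elim(2)] by (simp add: log_le_iff)
      then have "log 2 (E m) / real m \<le> (real m * a + 3) / real m"
        by (rule divide_right_mono) simp
      then show ?case using elim(2) by (simp add: add_divide_distrib)
    qed
  qed simp
  have "L_bound s p \<le> l"
  proof (cases "1 - s \<le> p")
    case True
    \<comment> \<open>The threshold is \<open>1 - s\<close>; by symmetry of the entropy the size of
      \<open>B m\<close> is also bounded by \<open>2^(m H(1 - s))\<close>.\<close>
    have "P m \<le> 2 * 2 powr (- (real m * bin_div (1 - s) p))" if "m \<ge> 1" for m
      unfolding P_def using p s True that B[OF that] cardB(2)[OF that]
      by (intro sum_type_profile_le) (auto simp: bin_entropy_complement)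
    then show ?thesis using lower True by (simp add: L_bound_def)
  next
    case False
    have "P m \<le> 2 * 2 powr (- (real m * 0))" if "m \<ge> 1" for m
      using P[OF that] by simp
    from lower[OF this] show ?thesis using False by (simp add: L_bound_def)
  qed
  moreover have "l \<le> bin_div s p"
  \<comment> \<open>For \<open>s = 1\<close> there is no room for a threshold above
    \<open>s\<close>. One bin suffices instead: each has profile at least \<open>p^m\<close>, which
    is \<open>2^(-m D(1|p))\<close>.\<close>
  proof (cases "s = 1")
    case True
    have "2 powr (- (real m * bin_div s p)) / 8 \<le> P m" if m: "m \<ge> 1" for m
    proof -
      obtain b where b: "b \<in> B m" using cardB(3)[OF m] by fastforce
      have "cross_entropy (bin_type b) p - cross_entropy 1 p \<le> 0"
        unfolding cross_entropy_diff using p bin_type_bounds[of b]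
        by (intro mult_nonpos_nonneg) auto
      then have "2 powr (- (real m * cross_entropy 1 p)) \<le> type_profile p m b"
        using p p1 by (simp add: type_profile_eq_powr mult_left_mono)
      also have "cross_entropy 1 p = bin_div s p"
        using bin_entropy_plus_bin_div[OF p(1) p1, of 1] True by (simp add: bin_entropy_def)
      also have "type_profile p m b \<le> P m"
        unfolding P_def using b B[OF m] finite_subset[OF _ finite_bins]
        by (intro member_le_sum) (auto intro: less_imp_le type_profile_pos)
      finally show ?thesis using powr_ge_zero[of 2 "- (real m * bin_div s p)"] by linarith
    qed
    then show ?thesis by (intro upper) (auto simp: eventually_sequentially)
  next
    case False
    with s have s1: "s < 1" by simp
    have step: "l \<le> cross_entropy t p - bin_entropy s" if t: "s < t" "t < 1" for t
    proof (rule upper)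
      \<comment> \<open>Once \<open>m g \<ge> 3\<close>, the bins of type above \<open>t\<close>
        number at most \<open>X / 8\<close>, while \<open>B m\<close> has at least
        \<open>X / 4\<close> elements; at least \<open>X / 8\<close> remain.\<close>
      define g where "g = bin_entropy s - bin_entropy t"
      have "g > 0" using bin_entropy_strict_decreasing[OF s(1) t] by (simp add: g_def)
      then have "\<forall>\<^sub>F m in sequentially. real m \<ge> 3 / g"
        by (intro filterlim_at_top[THEN iffD1, rule_format] filterlim_real_sequentially)
      then show "\<forall>\<^sub>F m in sequentially.
          2 powr (- (real m * (cross_entropy t p - bin_entropy s))) / 8 \<le> P m"
        using eventually_ge_at_top[of 1]
      proof eventually_elim
        case (elim m)
        define c where "c = 2 powr (- (real m * cross_entropy t p))"
        define X where "X = 2 powr (real m * bin_entropy s)"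
        have "3 \<le> real m * g" using elim(1) \<open>g > 0\<close> by (simp add: field_simps)
        then have "real m * bin_entropy t \<le> real m * bin_entropy s - 3"
          by (simp add: g_def algebra_simps)
        then have "2 powr (real m * bin_entropy t) \<le> X / 8"
          using powr_mono[of "real m * bin_entropy t" "real m * bin_entropy s - 3" 2]
          by (simp add: X_def powr_diff)
        moreover have "X / 4 \<le> real (card (B m))"
          using cardB(1)[OF elim(2)] by (simp add: X_def mult.commute)
        ultimately have "X / 8 \<le> real (card (B m)) - 2 powr (real m * bin_entropy t)"
          by linarith
        then have "c * (X / 8) \<le> c * (real (card (B m)) - 2 powr (real m * bin_entropy t))"
          by (intro mult_left_mono) (auto simp: c_def)
        also have "\<dots> \<le> P m"
          unfolding c_def P_def using p s t elim(2) B[OF elim(2)]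
          by (intro sum_type_profile_ge) auto
        also have "c * (X / 8) = 2 powr (- (real m * (cross_entropy t p - bin_entropy s))) / 8"
          by (simp add: c_def X_def powr_add[symmetric] algebra_simps)
        finally show ?case .
      qed
    qed
    \<comment> \<open>The bound holds for every \<open>t\<close> above \<open>s\<close>, so
      \<open>t\<close> may decrease to \<open>s\<close>, where the right-hand side becomes
      \<open>bin_div s p\<close>.\<close>
    have "isCont (\<lambda>t. cross_entropy t p - bin_entropy s) s"
      unfolding cross_entropy_def by (intro continuous_intros)
    then have "((\<lambda>t. cross_entropy t p - bin_entropy s) \<longlongrightarrow> cross_entropy s p - bin_entropy s) (at_right s)"
      by (auto simp: isCont_def intro: filterlim_at_split[THEN iffD1, THEN conjunct2])
    moreover have "\<forall>\<^sub>F t in at_right s. l \<le> cross_entropy t p - bin_entropy s"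
      using s1 step by (auto simp: eventually_at_right)
    ultimately have "l \<le> cross_entropy s p - bin_entropy s"
      by (rule tendsto_lowerbound) simp
    then show ?thesis using bin_entropy_plus_bin_div[OF p(1) p1, of s] s by simp
  qed
  ultimately show ?thesis ..
qed

theorem theorem3:
  fixes p s \<epsilon> :: real and n :: "nat \<Rightarrow> nat" and B :: "nat \<Rightarrow> bool list set"
  assumes "0 < p" and "p \<le> 1/2"
    and "1/2 \<le> s" and "s \<le> 1"
    and "0 < \<epsilon>"
    and "\<And>m. m \<ge> 1 \<Longrightarrow> real (n m) \<ge> (1 + \<epsilon>) * real m * log 2 (1 / p)"
    and "\<And>m b. m \<ge> 1 \<Longrightarrow> b \<in> bins m \<Longrightarrow> 2 ^ n m * type_profile p m b \<in> \<int>"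
    and "\<And>m. m \<ge> 1 \<Longrightarrow> B m \<subseteq> bins m"
    and "\<And>m. m \<ge> 1 \<Longrightarrow>
           card (B m) = max 1 (nat \<lfloor>2 powr (bin_entropy s * real m - 1)\<rfloor>)"
  shows "(\<forall>\<sigma> l. (\<forall>m\<ge>1. \<sigma> m \<in> strategies (n m)) \<longrightarrow>
            (\<lambda>m. 1 / real m * log 2 (E_hash (n m) m (type_profile p m) (\<sigma> m) (B m)))
              \<longlonglongrightarrow> l \<longrightarrow>
            L_bound s p \<le> l \<and> l \<le> bin_div s p) \<and>
         (\<forall>h l. (\<forall>m\<ge>1. h m \<in> profile_set (n m) m (type_profile p m)) \<longrightarrow>
            (\<lambda>m. 1 / real m * log 2 (E_strategy (n m) (h m) (B m))) \<longlonglongrightarrow> l \<longrightarrow>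
            L_bound s p \<le> l \<and> l \<le> bin_div s p)"
proof (intro conjI allI impI)
  note p = assms(1,2) and s = assms(3,4) and int = assms(7) and B = assms(8) and card = assms(9)
  have p1: "p < 1" using p by simp
  have K: "2 ^ n m * (\<Sum>b\<in>B m. type_profile p m b) \<in> \<int>" if "m \<ge> 1" for m
    unfolding sum_distrib_left using int[OF that] B[OF that] by (intro Ints_sum) blast
  note bounds = insider_rate_bounds[OF p s B card K]
  {
    fix \<sigma> l
    assume \<sigma>: "\<forall>m\<ge>1. \<sigma> m \<in> strategies (n m)"
      and "(\<lambda>m. 1 / real m * log 2 (E_hash (n m) m (type_profile p m) (\<sigma> m) (B m))) \<longlonglongrightarrow> l"
    moreover have "E_hash (n m) m (type_profile p m) (\<sigma> m) (B m)
        = (2 ^ n m + 1) / (2 ^ n m * (\<Sum>b\<in>B m. type_profile p m b) + 1)" if "m \<ge> 1" for m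
    proof (rule E_hash_eq)
      \<comment> \<open>Integrality of all \<open>2 ^ n m * type_profile p m b\<close> and total
        mass 1 yield a hash function with this profile.\<close>
      show "profile_set (n m) m (type_profile p m) \<noteq> {}"
        using int[OF that] sum_type_profile[OF p(1) p1 that]
        by (intro profile_set_nonempty) (auto intro: less_imp_le type_profile_pos)
    qed (use \<sigma> B that in auto)
    ultimately have "L_bound s p \<le> l \<and> l \<le> bin_div s p" by (intro bounds)
    then show "L_bound s p \<le> l" "l \<le> bin_div s p" by auto
  }
  {
    fix h l
    assume h: "\<forall>m\<ge>1. h m \<in> profile_set (n m) m (type_profile p m)"
      and "(\<lambda>m. 1 / real m * log 2 (E_strategy (n m) (h m) (B m))) \<longlonglongrightarrow> l"
    moreover have "E_strategy (n m) (h m) (B m)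
        = (2 ^ n m + 1) / (2 ^ n m * (\<Sum>b\<in>B m. type_profile p m b) + 1)" if "m \<ge> 1" for m
      using card_preimage_profile_set[of "h m" "n m" m "type_profile p m" "B m"] h B[OF that] that
      by (simp add: E_strategy_eq)
    ultimately have "L_bound s p \<le> l \<and> l \<le> bin_div s p" by (intro bounds)
    then show "L_bound s p \<le> l" "l \<le> bin_div s p" by auto
  }
qed

end
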